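(* Let $\Gamma$ be a groupoid, let $R$ be a $d$-finitely generated $\Gamma$-graded ring, and write $R=\sum_{e\in\Delta_0}R1_eR$ for a finite subset $\Delta_0\subseteq\Gamma_0$. Suppose that $U$ is a graded (two-sided) ideal of $R$. Then the following are equivalent: $U$ is nilpotent; $U$ is right objectwise nilpotent; $U$ is left objectwise nilpotent; $U$ is $\Gamma_0$-nilpotent; $1_eU1_e$ is nilpotent for every $e\in\Delta_0$.
   Context: A groupoid $\Gamma$ is the set of morphisms of a small category in which all morphisms are invertible; $\Gamma_0\subseteq\Gamma$ is the set of identity morphisms; $d(\gamma)=\gamma^{-1}\gamma$, $r(\gamma)=\gamma\gamma^{-1}$; the product $\gamma\delta$ is defined iff $d(\gamma)=r(\delta)$. Rings are associative, not necessarily unital. A $\Gamma$-graded ring is a ring $R=\bigoplus_{\gamma\in\Gamma}R_\gamma$ (additive subgroups) with $R_\gamma R_\delta\subseteq R_{\gamma\delta}$ if $d(\gamma)=r(\delta)$ and $R_\gamma R_\delta=0$ otherwise; it is always assumed object unital: for each $e\in\Gamma_0$ the ring $R_e$ has an identity $1_e$ (possibly $0$) with $1_{r(\gamma)}a=a=a1_{d(\gamma)}$ for all $a\in R_\gamma$, $\gamma\in\Gamma$. An ideal $U$ is graded if $U=\bigoplus_\gamma (U\cap R_\gamma)$. $R$ is $d$-finitely generated if $R=\sum_{e\in\Delta_0}R1_eR$ for some finite $\Delta_0\subseteq\Gamma_0$. A subset $V$ of $R$ that is an additive subgroup closed under multiplication is nilpotent if $V^n=0$ for some positive integer $n$. A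 graded ideal $U$ is $\Gamma_0$-nilpotent if for each $e\in\Gamma_0$ there is a positive integer $n_e$ with $(1_eU)^{n_e}=0$; it is right (resp. left) objectwise nilpotent if for each $e\in\Gamma_0$ there is a positive integer $n_e$ with $1_eU^{n_e}=0$ (resp. $U^{n_e}1_e=0$). *)

theory Defs
  imports
    Main
    "HOL-Library.Set_Algebras"
    "HOL-Computational_Algebra.Group_Closure"
begin

record ('o, 'g) cat =
  Obj :: "'o set"
  Mor :: "'g set"
  Src :: "'g \<Rightarrow> 'o"
  Tgt :: "'g \<Rightarrow> 'o"
  Idt :: "'o \<Rightarrow> 'g"
  Comp :: "'g \<Rightarrow> 'g \<Rightarrow> 'g"

text \<open>Composition is written as for functions: \<open>Comp \<Gamma> g h\<close> means ``first \<open>h\<close>, then \<open>g\<close>'', and is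
  meaningful only when \<open>Src \<Gamma> g = Tgt \<Gamma> h\<close>.\<close>

locale small_category =
  fixes \<Gamma> :: "('o, 'g) cat"
  assumes Src_Obj: "g \<in> Mor \<Gamma> \<Longrightarrow> Src \<Gamma> g \<in> Obj \<Gamma>"
    and Tgt_Obj: "g \<in> Mor \<Gamma> \<Longrightarrow> Tgt \<Gamma> g \<in> Obj \<Gamma>"
    and Idt_Mor: "x \<in> Obj \<Gamma> \<Longrightarrow> Idt \<Gamma> x \<in> Mor \<Gamma>"
    and Src_Idt: "x \<in> Obj \<Gamma> \<Longrightarrow> Src \<Gamma> (Idt \<Gamma> x) = x"
    and Tgt_Idt: "x \<in> Obj \<Gamma> \<Longrightarrow> Tgt \<Gamma> (Idt \<Gamma> x) = x"
    and Comp_Mor: "\<lbrakk>g \<in> Mor \<Gamma>; h \<in> Mor \<Gamma>; Src \<Gamma> g = Tgt \<Gamma> h\<rbrakk> \<Longrightarrow> Comp \<Gamma> g h \<in> Mor \<Gamma>"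
    and Src_Comp: "\<lbrakk>g \<in> Mor \<Gamma>; h \<in> Mor \<Gamma>; Src \<Gamma> g = Tgt \<Gamma> h\<rbrakk>
      \<Longrightarrow> Src \<Gamma> (Comp \<Gamma> g h) = Src \<Gamma> h"
    and Tgt_Comp: "\<lbrakk>g \<in> Mor \<Gamma>; h \<in> Mor \<Gamma>; Src \<Gamma> g = Tgt \<Gamma> h\<rbrakk>
      \<Longrightarrow> Tgt \<Gamma> (Comp \<Gamma> g h) = Tgt \<Gamma> g"
    and Comp_assoc: "\<lbrakk>g \<in> Mor \<Gamma>; h \<in> Mor \<Gamma>; k \<in> Mor \<Gamma>; Src \<Gamma> g = Tgt \<Gamma> h; Src \<Gamma> h = Tgt \<Gamma> k\<rbrakk>
      \<Longrightarrow> Comp \<Gamma> (Comp \<Gamma> g h) k = Comp \<Gamma> g (Comp \<Gamma> h k)"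
    and Comp_Idt: "g \<in> Mor \<Gamma> \<Longrightarrow> Comp \<Gamma> g (Idt \<Gamma> (Src \<Gamma> g)) = g"
    and Idt_Comp: "g \<in> Mor \<Gamma> \<Longrightarrow> Comp \<Gamma> (Idt \<Gamma> (Tgt \<Gamma> g)) g = g"

definition inverse_of :: "('o, 'g) cat \<Rightarrow> 'g \<Rightarrow> 'g \<Rightarrow> bool" where
  "inverse_of \<Gamma> g h \<longleftrightarrow> h \<in> Mor \<Gamma> \<and> Src \<Gamma> h = Tgt \<Gamma> g \<and> Tgt \<Gamma> h = Src \<Gamma> g
     \<and> Comp \<Gamma> h g = Idt \<Gamma> (Src \<Gamma> g) \<and> Comp \<Gamma> g h = Idt \<Gamma> (Tgt \<Gamma> g)"

locale groupoid = small_category +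
  assumes invertible: "g \<in> Mor \<Gamma> \<Longrightarrow> \<exists>h. inverse_of \<Gamma> g h"

definition ginv :: "('o, 'g) cat \<Rightarrow> 'g \<Rightarrow> 'g" where
  "ginv \<Gamma> g = (THE h. inverse_of \<Gamma> g h)"

definition dm :: "('o, 'g) cat \<Rightarrow> 'g \<Rightarrow> 'g" where
  "dm \<Gamma> g = Comp \<Gamma> (ginv \<Gamma> g) g"

definition rg :: "('o, 'g) cat \<Rightarrow> 'g \<Rightarrow> 'g" where
  "rg \<Gamma> g = Comp \<Gamma> g (ginv \<Gamma> g)"

definition idents :: "('o, 'g) cat \<Rightarrow> 'g set" where
  "idents \<Gamma> = Idt \<Gamma> ` Obj \<Gamma>"

context groupoid
begin

lemma inverse_of_ginv:
  assumes g: "g \<in> Mor \<Gamma>"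
  shows "inverse_of \<Gamma> g (ginv \<Gamma> g)"
proof -
  obtain h where h: "inverse_of \<Gamma> g h"
    using invertible[OF g] by blast
  have "k = h" if k: "inverse_of \<Gamma> g k" for k
  proof -
    have "k = Comp \<Gamma> k (Comp \<Gamma> g h)"
      using h k Comp_Idt[of k] by (simp add: inverse_of_def)
    also have "\<dots> = Comp \<Gamma> (Comp \<Gamma> k g) h"
      using g h k Comp_assoc[of k g h] by (simp add: inverse_of_def)
    also have "\<dots> = h"
      using h k Idt_Comp[of h] by (simp add: inverse_of_def)
    finally show ?thesis .
  qed
  with h show ?thesis
    unfolding ginv_def by (rule theI[of "inverse_of \<Gamma> g"])
qed

lemma dm_eq: "g \<in> Mor \<Gamma> \<Longrightarrow> dm \<Gamma> g = Idt \<Gamma> (Src \<Gamma> g)"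
  using inverse_of_ginv[of g] by (simp add: dm_def inverse_of_def)

lemma rg_eq: "g \<in> Mor \<Gamma> \<Longrightarrow> rg \<Gamma> g = Idt \<Gamma> (Tgt \<Gamma> g)"
  using inverse_of_ginv[of g] by (simp add: rg_def inverse_of_def)

lemma composable_iff:
  assumes "g \<in> Mor \<Gamma>" "h \<in> Mor \<Gamma>"
  shows "dm \<Gamma> g = rg \<Gamma> h \<longleftrightarrow> Src \<Gamma> g = Tgt \<Gamma> h"
  using assms by (metis dm_eq rg_eq Src_Idt Src_Obj Tgt_Obj)

end

text \<open>The type class \<open>ring\<close> does not require an identity element; the ring \<open>R\<close> is the whole
  type \<open>'a\<close>.\<close>

definition add_subgroup :: "'a::ab_group_add set \<Rightarrow> bool" where
  "add_subgroup S \<longleftrightarrow> 0 \<in> S \<and> (\<forall>x\<in>S. \<forall>y\<in>S. x - y \<in> S)"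

definition finsupp_families :: "'i set \<Rightarrow> ('i \<Rightarrow> 'a::ab_group_add set) \<Rightarrow> ('i \<Rightarrow> 'a) set" where
  "finsupp_families I S =
     {f. (\<forall>i\<in>I. f i \<in> S i) \<and> (\<forall>i. i \<notin> I \<longrightarrow> f i = 0) \<and> finite {i. f i \<noteq> 0}}"

text \<open>\<open>A\<close> is the internal direct sum of the additive subgroups \<open>S i\<close>: every element of \<open>A\<close> is the sum
  of a unique finitely supported family, and all such sums lie in \<open>A\<close>.\<close>

definition internal_direct_sum ::
  "'i set \<Rightarrow> ('i \<Rightarrow> 'a::ab_group_add set) \<Rightarrow> 'a set \<Rightarrow> bool" where
  "internal_direct_sum I S A \<longleftrightarrow> (\<forall>i\<in>I. add_subgroup (S i))
     \<and> bij_betw (\<lambda>f. \<Sum>i\<in>{i. f i \<noteq> 0}. f i) (finsupp_families I S) A"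

definition two_sided_ideal :: "'a::ring set \<Rightarrow> bool" where
  "two_sided_ideal U \<longleftrightarrow> add_subgroup U \<and> (\<forall>u\<in>U. \<forall>a. a * u \<in> U \<and> u * a \<in> U)"

text \<open>The elementwise set product \<open>A * B\<close> comes from \<^theory>\<open>HOL-Library.Set_Algebras\<close>; products of
  additive subgroups are the additive subgroups generated by it.\<close>

definition sg_prod :: "'a::ring set \<Rightarrow> 'a set \<Rightarrow> 'a set" where
  "sg_prod A B = group_closure (A * B)"

text \<open>Only positive exponents matter; the value at \<open>0\<close> is a convention.\<close>

fun sg_power :: "'a::ring set \<Rightarrow> nat \<Rightarrow> 'a set" where
  "sg_power V 0 = UNIV"
| "sg_power V (Suc 0) = V"
| "sg_power V (Suc (Suc n)) = sg_prod (sg_power V (Suc n)) V"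

text \<open>Used only for additive subgroups \<open>V\<close> that are closed under multiplication.\<close>

definition nilpotent :: "'a::ring set \<Rightarrow> bool" where
  "nilpotent V \<longleftrightarrow> (\<exists>n>0. sg_power V n = {0})"

text \<open>For \<open>e\<close> in \<open>idents \<Gamma>\<close> one has \<open>dm \<Gamma> e = rg \<Gamma> e = e\<close>, so the last two axioms also say that
  \<open>one e\<close> is the identity of the ring \<open>R e\<close>.\<close>

locale graded_ring = groupoid \<Gamma> for \<Gamma> :: "('o, 'g) cat" +
  fixes R :: "'g \<Rightarrow> 'a::ring set"
    and one :: "'g \<Rightarrow> 'a"
  assumes direct_sum: "internal_direct_sum (Mor \<Gamma>) R UNIV"
    and mult_closed: "\<lbrakk>g \<in> Mor \<Gamma>; h \<in> Mor \<Gamma>; dm \<Gamma> g = rg \<Gamma> h\<rbrakk>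
      \<Longrightarrow> sg_prod (R g) (R h) \<subseteq> R (Comp \<Gamma> g h)"
    and mult_zero: "\<lbrakk>g \<in> Mor \<Gamma>; h \<in> Mor \<Gamma>; dm \<Gamma> g \<noteq> rg \<Gamma> h\<rbrakk> \<Longrightarrow> sg_prod (R g) (R h) = {0}"
    and one_mem: "e \<in> idents \<Gamma> \<Longrightarrow> one e \<in> R e"
    and one_left: "\<lbrakk>g \<in> Mor \<Gamma>; a \<in> R g\<rbrakk> \<Longrightarrow> one (rg \<Gamma> g) * a = a"
    and one_right: "\<lbrakk>g \<in> Mor \<Gamma>; a \<in> R g\<rbrakk> \<Longrightarrow> a * one (dm \<Gamma> g) = a"

definition graded_ideal :: "('o, 'g) cat \<Rightarrow> ('g \<Rightarrow> 'a::ring set) \<Rightarrow> 'a set \<Rightarrow> bool" where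
  "graded_ideal \<Gamma> R U \<longleftrightarrow> two_sided_ideal U \<and> internal_direct_sum (Mor \<Gamma>) (\<lambda>g. U \<inter> R g) U"

definition ideal_at :: "('g \<Rightarrow> 'a::ring) \<Rightarrow> 'g \<Rightarrow> 'a set" where
  "ideal_at one e = sg_prod (sg_prod UNIV {one e}) UNIV"

text \<open>The sum below is the sum of subsets of \<open>'a\<close> from \<^theory>\<open>HOL-Library.Set_Algebras\<close>.\<close>

definition d_generating :: "('o, 'g) cat \<Rightarrow> ('g \<Rightarrow> 'a::ring) \<Rightarrow> 'g set \<Rightarrow> bool" where
  "d_generating \<Gamma> one \<Delta> \<longleftrightarrow> finite \<Delta> \<and> \<Delta> \<subseteq> idents \<Gamma> \<and> UNIV = (\<Sum>e\<in>\<Delta>. ideal_at one e)"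

definition d_finitely_generated :: "('o, 'g) cat \<Rightarrow> ('g \<Rightarrow> 'a::ring) \<Rightarrow> bool" where
  "d_finitely_generated \<Gamma> one \<longleftrightarrow> (\<exists>\<Delta>. d_generating \<Gamma> one \<Delta>)"

definition right_objectwise_nilpotent ::
  "('o, 'g) cat \<Rightarrow> ('g \<Rightarrow> 'a::ring) \<Rightarrow> 'a set \<Rightarrow> bool" where
  "right_objectwise_nilpotent \<Gamma> one U \<longleftrightarrow>
     (\<forall>e\<in>idents \<Gamma>. \<exists>n>0. (\<lambda>u. one e * u) ` sg_power U n = {0})"

definition left_objectwise_nilpotent ::
  "('o, 'g) cat \<Rightarrow> ('g \<Rightarrow> 'a::ring) \<Rightarrow> 'a set \<Rightarrow> bool" where
  "left_objectwise_nilpotent \<Gamma> one U \<longleftrightarrow>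
     (\<forall>e\<in>idents \<Gamma>. \<exists>n>0. (\<lambda>u. u * one e) ` sg_power U n = {0})"

definition object_nilpotent ::
  "('o, 'g) cat \<Rightarrow> ('g \<Rightarrow> 'a::ring) \<Rightarrow> 'a set \<Rightarrow> bool" where
  "object_nilpotent \<Gamma> one U \<longleftrightarrow>
     (\<forall>e\<in>idents \<Gamma>. \<exists>n>0. sg_power ((\<lambda>u. one e * u) ` U) n = {0})"

end

theory Submission
  imports Defs
begin

text \<open>The heart of the matter is that nilpotency of \<open>1\<^sub>e U 1\<^sub>e\<close> for all \<open>e\<close> in \<open>\<Delta>\<close> forces \<open>U\<close> to be
  nilpotent. Put \<open>I\<^sub>e = R 1\<^sub>e U\<close>. In a product \<open>(r\<^sub>0 1\<^sub>e u\<^sub>0) (r\<^sub>1 1\<^sub>e u\<^sub>1) \<dots> (r\<^sub>n 1\<^sub>e u\<^sub>n)\<close> the pieces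
  \<open>1\<^sub>e (u\<^sub>i r\<^sub>i\<^sub>+\<^sub>1) 1\<^sub>e\<close> lie in \<open>1\<^sub>e U 1\<^sub>e\<close>, so the ideal \<open>I\<^sub>e\<close> is nilpotent. Hence so is the finite sum of
  the \<open>I\<^sub>e\<close> with \<open>e\<close> in \<open>\<Delta>\<close>, and it contains \<open>U\<^sup>2\<close> because \<open>R\<close> is the sum of the \<open>R 1\<^sub>e R\<close>.\<close>

text \<open>The index is shifted: \<open>nprod V n\<close> is the set of products of \<open>n + 1\<close> elements of \<open>V\<close>.\<close>

fun nprod :: "'a::ring set \<Rightarrow> nat \<Rightarrow> 'a set" where
  "nprod V 0 = V"
| "nprod V (Suc n) = nprod V n * V"

section \<open>Additive closures of products\<close>

lemma group_closure_least:
  assumes "add_subgroup A" "S \<subseteq> A"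
  shows "group_closure S \<subseteq> A"
proof
  fix x assume "x \<in> group_closure S"
  then show "x \<in> A"
    using assms by induction (auto simp: add_subgroup_def)
qed

lemma group_closure_increasing: "S \<subseteq> group_closure S"
  by (auto intro: group_closure.base)

lemma add_subgroup_group_closure: "add_subgroup (group_closure S)"
  by (auto simp: add_subgroup_def intro: group_closure.diff)

lemma add_subgroup_add: "add_subgroup A \<Longrightarrow> x \<in> A \<Longrightarrow> y \<in> A \<Longrightarrow> x + y \<in> A"
  unfolding add_subgroup_def by (metis diff_0 diff_minus_eq_add)

text \<open>By distributivity, the elements that a fixed factor multiplies into \<open>C\<close>
  form a subgroup. This is applied to each \<open>b\<close> in \<open>B\<close> first, then to each
  \<open>a\<close> in the closure of \<open>A\<close>.\<close>

lemma group_closure_mult_mem: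
  fixes A B :: "'a::ring set"
  assumes C: "add_subgroup C" and AB: "A * B \<subseteq> C"
  shows "group_closure A * group_closure B \<subseteq> C"
proof -
  have 1: "group_closure A \<subseteq> {x. x * b \<in> C}" if "b \<in> B" for b
    using AB C that
    by (intro group_closure_least) (auto simp: add_subgroup_def left_diff_distrib)
  have "group_closure B \<subseteq> {y. a * y \<in> C}" if "a \<in> group_closure A" for a
    using 1 C that
    by (intro group_closure_least) (auto simp: add_subgroup_def right_diff_distrib)
  then show ?thesis
    by (auto elim!: set_times_elim)
qed

lemma group_closure_mult:
  fixes A B :: "'a::ring set"
  shows "group_closure A * group_closure B \<subseteq> group_closure (A * B)"
  by (intro group_closure_mult_mem add_subgroup_group_closure group_closure_increasing)

section \<open>Products of a fixed number of elements, and nilpotency\<close>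

lemma nprod_mono: "V \<subseteq> W \<Longrightarrow> nprod V n \<subseteq> nprod W n"
  by (induction n) (simp_all add: set_times_mono2)

lemma nprod_add: "nprod V (Suc (m + n)) = nprod V m * nprod V n"
  by (induction n) (auto simp: mult.assoc)

text \<open>There are \<open>n + 1\<close> blocks of \<open>m + 1\<close> factors each; the final
  \<open>- 1\<close> returns to the shifted index.\<close>

lemma nprod_nprod: "nprod (nprod V m) n = nprod V (Suc m * Suc n - 1)"
proof (induction n)
  case (Suc n)
  have "Suc m * Suc (Suc n) - 1 = Suc ((Suc m * Suc n - 1) + m)"
    by simp
  then show ?case
    using Suc nprod_add[of V "Suc m * Suc n - 1" m]
    by (simp only: nprod.simps(2)[of "nprod V m"])
qed simp

lemma nprod_group_closure: "nprod (group_closure S) n \<subseteq> group_closure (nprod S n)"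
proof (induction n)
  case (Suc n)
  then have "nprod (group_closure S) (Suc n) \<subseteq> group_closure (nprod S n) * group_closure S"
    by (simp add: set_times_mono2)
  then show ?case
    using group_closure_mult by fastforce
qed simp

text \<open>With \<open>sg_power_subset_group_closure\<close> this squeezes a power between the
  products of elements and their additive closure.\<close>

lemma nprod_subset_sg_power: "nprod V n \<subseteq> sg_power V (Suc n)"
proof (induction n)
  case (Suc n)
  then have "nprod V n * V \<subseteq> sg_power V (Suc n) * V"
    by (simp only: set_times_mono2 order_refl)
  then show ?case
    using group_closure_increasing by (fastforce simp: sg_prod_def)
qed simp

lemma sg_power_subset_group_closure: "sg_power V (Suc n) \<subseteq> group_closure (nprod V n)"
proof (induction n)
  case 0
  then show ?case
    by (simp add: group_closure_increasing)
next
  case (Suc n)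
  then have "sg_power V (Suc n) * V \<subseteq> group_closure (nprod V n) * group_closure V"
    by (intro set_times_mono2 group_closure_increasing)
  also have "\<dots> \<subseteq> group_closure (nprod V (Suc n))"
    using group_closure_mult by fastforce
  finally show ?case
    by (simp add: sg_prod_def group_closure_least add_subgroup_group_closure)
qed

text \<open>Vanishing is tested on products of elements, so nilpotency also becomes usable for mere
  generating sets such as \<open>UNIV * ({e} * U)\<close>.\<close>

lemma nilpotent_iff: "nilpotent V \<longleftrightarrow> (\<exists>n. nprod V n \<subseteq> {0})"
proof
  assume "nilpotent V"
  then obtain n where "n > 0" "sg_power V n = {0}"
    by (auto simp: nilpotent_def)
  then show "\<exists>n. nprod V n \<subseteq> {0}"
    using nprod_subset_sg_power[of V "n - 1"] by auto
next
  assume "\<exists>n. nprod V n \<subseteq> {0}"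
  then obtain n where n: "nprod V n \<subseteq> {0}" ..
  \<comment> \<open>One more factor, so that the power contains \<open>0\<close> even when \<open>V\<close> is empty.\<close>
  have "nprod V (Suc n) \<subseteq> {0}"
    using n by (force elim!: set_times_elim)
  then have "group_closure (nprod V (Suc n)) \<subseteq> {0}"
    by (intro group_closure_least) (auto simp: add_subgroup_def)
  then have "sg_power V (Suc (Suc n)) = {0}"
    using sg_power_subset_group_closure[of V "Suc n"] by (auto simp: sg_prod_def)
  then show "nilpotent V"
    unfolding nilpotent_def by blast
qed

lemma nilpotent_subset: "nilpotent W \<Longrightarrow> V \<subseteq> W \<Longrightarrow> nilpotent V"
  unfolding nilpotent_iff by (meson nprod_mono order_trans)

text \<open>Blocks of \<open>m + 1\<close> factors from \<open>V\<close> lie in \<open>W\<close>,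
  and enough blocks multiply to zero.\<close>

lemma nilpotent_nprod_subset:
  assumes "nilpotent W" "nprod V m \<subseteq> W"
  shows "nilpotent V"
proof -
  have "nilpotent (nprod V m)"
    using assms by (rule nilpotent_subset)
  then show ?thesis
    by (auto simp only: nilpotent_iff nprod_nprod)
qed

lemma nilpotent_group_closure:
  assumes "nilpotent S"
  shows "nilpotent (group_closure S)"
proof -
  obtain n where n: "nprod S n \<subseteq> {0}"
    using assms by (auto simp: nilpotent_iff)
  have "group_closure (nprod S n) \<subseteq> {0}"
    using n by (intro group_closure_least) (auto simp: add_subgroup_def)
  then show ?thesis
    using nprod_group_closure[of S n] unfolding nilpotent_iff by blast
qed

section \<open>Finite sums of nilpotent ideals\<close>

lemma nprod_plus_ideal:
  assumes "two_sided_ideal K"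
  shows "nprod (I + K) n \<subseteq> nprod I n + K"
proof (induction n)
  case (Suc n)
  show ?case
  proof
    fix x assume "x \<in> nprod (I + K) (Suc n)"
    then obtain y z where x: "x = y * z" and y: "y \<in> nprod I n + K" and z: "z \<in> I + K"
      using Suc by (auto elim!: set_times_elim)
    obtain p k where p: "y = p + k" "p \<in> nprod I n" "k \<in> K"
      using y by (auto elim!: set_plus_elim)
    obtain i l where i: "z = i + l" "i \<in> I" "l \<in> K"
      using z by (auto elim!: set_plus_elim)
    \<comment> \<open>Computation modulo \<open>K\<close>: apart from \<open>p * i\<close>, each
      term has a factor in \<open>K\<close>.\<close>
    have "x = p * i + (p * l + k * z)"
      by (simp add: x p i algebra_simps)
    moreover have "p * l + k * z \<in> K"
      using assms p i y z unfolding two_sided_ideal_def by (blast intro: add_subgroup_add)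
    ultimately show "x \<in> nprod I (Suc n) + K"
      using p i by auto
  qed
qed simp

lemma two_sided_ideal_plus:
  assumes "two_sided_ideal I" "two_sided_ideal K"
  shows "two_sided_ideal (I + K)"
proof -
  have "x - y \<in> I + K" if xy: "x \<in> I + K" "y \<in> I + K" for x y
  proof -
    obtain a b where x: "x = a + b" "a \<in> I" "b \<in> K"
      using xy(1) by (auto elim!: set_plus_elim)
    obtain c d where y: "y = c + d" "c \<in> I" "d \<in> K"
      using xy(2) by (auto elim!: set_plus_elim)
    have "x - y = (a - c) + (b - d)"
      by (simp add: x y)
    moreover have "a - c \<in> I" "b - d \<in> K"
      using assms x y by (auto simp: two_sided_ideal_def add_subgroup_def)
    ultimately show ?thesis
      by (simp only: set_plus_intro)
  qed
  moreover have "0 \<in> I + K"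
    using assms set_plus_intro[of 0 I 0 K] by (auto simp: two_sided_ideal_def add_subgroup_def)
  moreover have "a * x \<in> I + K \<and> x * a \<in> I + K" if "x \<in> I + K" for a x
    using assms that
    by (auto simp: two_sided_ideal_def distrib_left distrib_right elim!: set_plus_elim
        intro!: set_plus_intro)
  ultimately show ?thesis
    by (auto simp: two_sided_ideal_def add_subgroup_def)
qed

text \<open>Modulo \<open>K\<close> only products from \<open>I\<close> survive, so long products
  from \<open>I + K\<close> fall into the nilpotent \<open>K\<close>.\<close>

lemma nilpotent_plus:
  assumes "nilpotent I" "nilpotent K" "two_sided_ideal K"
  shows "nilpotent (I + K)"
proof -
  obtain n where "nprod I n \<subseteq> {0}"
    using assms(1) by (auto simp: nilpotent_iff)
  then have "nprod I n + K \<subseteq> K"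
    by (auto elim!: set_plus_elim)
  then have "nprod (I + K) n \<subseteq> K"
    using nprod_plus_ideal[OF assms(3)] by blast
  then show ?thesis
    using assms(2) by (rule nilpotent_nprod_subset[rotated])
qed

lemma nilpotent_ideal_sum:
  assumes "finite F" "\<And>e. e \<in> F \<Longrightarrow> two_sided_ideal (I e)" "\<And>e. e \<in> F \<Longrightarrow> nilpotent (I e)"
  shows "two_sided_ideal (\<Sum>e\<in>F. I e) \<and> nilpotent (\<Sum>e\<in>F. I e)"
  using assms
proof (induction F rule: finite_induct)
  case empty
  \<comment> \<open>The empty sum of sets is \<open>{0}\<close>; index \<open>0\<close> already
    stands for one factor.\<close>
  have "nilpotent {0}"
    unfolding nilpotent_iff by (rule exI[of _ 0]) simp
  then show ?case
    by (simp add: set_zero two_sided_ideal_def add_subgroup_def)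
next
  case (insert e F)
  then show ?case
    by (simp add: two_sided_ideal_plus nilpotent_plus)
qed

lemma sum_set_mult_right:
  fixes A B :: "'i \<Rightarrow> 'a::ring set"
  assumes "finite F" "x \<in> (\<Sum>e\<in>F. A e)" "\<And>e a. e \<in> F \<Longrightarrow> a \<in> A e \<Longrightarrow> a * u \<in> B e"
  shows "x * u \<in> (\<Sum>e\<in>F. B e)"
  using assms
proof (induction F arbitrary: x rule: finite_induct)
  case empty
  then show ?case
    by (simp add: set_zero)
next
  case (insert e F)
  have "x \<in> A e + sum A F"
    using insert by simp
  then obtain a b where x: "x = a + b" "a \<in> A e" "b \<in> sum A F"
    by (rule set_plus_elim)
  have "a * u + b * u \<in> B e + sum B F"
    using insert x by (intro set_plus_intro) auto
  then show ?case
    using insert x by (simp add: distrib_right)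
qed

section \<open>The ideal spanned by the products \<open>r * (e * u)\<close>\<close>

lemma two_sided_ideal_corner_ideal:
  assumes U: "two_sided_ideal U"
  shows "two_sided_ideal (group_closure (UNIV * ({e} * U)))"
proof -
  let ?S = "UNIV * ({e} * U)"
  have left: "a * s \<in> ?S" if s: "s \<in> ?S" for a s
  proof -
    obtain r t where "s = r * t" "t \<in> {e} * U"
      using s by (rule set_times_elim)
    then have "a * s = (a * r) * t" "t \<in> {e} * U"
      by (simp_all add: mult.assoc)
    then show ?thesis
      by (simp only: set_times_intro UNIV_I)
  qed
  have right: "s * a \<in> ?S" if s: "s \<in> ?S" for a s
  proof -
    obtain r u where s: "s = r * (e * u)" "u \<in> U"
      using s by (auto elim!: set_times_elim)
    then have "s * a = r * (e * (u * a))" "u * a \<in> U"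
      using U by (simp_all add: mult.assoc two_sided_ideal_def)
    then show ?thesis
      by (simp only: set_times_intro UNIV_I singletonI)
  qed
  \<comment> \<open>Multiplication by \<open>a\<close> is additive, so absorption need only be
    checked on generators.\<close>
  have "group_closure ?S \<subseteq> {x. a * x \<in> group_closure ?S}" for a
    using left by (intro group_closure_least)
      (auto simp: add_subgroup_def right_diff_distrib intro: group_closure.intros)
  moreover have "group_closure ?S \<subseteq> {x. x * a \<in> group_closure ?S}" for a
    using right by (intro group_closure_least)
      (auto simp: add_subgroup_def left_diff_distrib intro: group_closure.intros)
  ultimately show ?thesis
    using add_subgroup_group_closure by (auto simp: two_sided_ideal_def)
qed

lemma nprod_corner_right_unit:
  assumes "e * e = e" "w \<in> nprod ((\<lambda>u. e * u * e) ` U) n"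
  shows "w * e = w"
  using assms by (cases n) (auto simp: mult.assoc elim!: set_times_elim)

text \<open>The \<open>n + 2\<close> factors have \<open>n + 1\<close> gaps, and each gap yields one
  corner element; the first \<open>r\<close> and the last \<open>u\<close> stay outside.\<close>

lemma nprod_corner_ideal:
  assumes U: "two_sided_ideal U" and e: "e * e = e"
  shows "nprod (UNIV * ({e} * U)) (Suc n) \<subseteq> UNIV * (nprod ((\<lambda>u. e * u * e) ` U) n * U)"
    (is "nprod ?S _ \<subseteq> UNIV * (nprod ?P _ * U)")
proof (induction n)
  case 0
  show ?case
  proof
    fix x assume "x \<in> nprod ?S (Suc 0)"
    then obtain r u s v where x: "x = (r * (e * u)) * (s * (e * v))" "u \<in> U" "v \<in> U"
      by (auto elim!: set_times_elim)
    have "x = r * ((e * (u * s) * e) * v)"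
      by (simp add: x mult.assoc)
    moreover have "u * s \<in> U"
      using U x by (auto simp: two_sided_ideal_def)
    ultimately show "x \<in> UNIV * (nprod ?P 0 * U)"
      using x(3) by auto
  qed
next
  case (Suc n)
  show ?case
  proof
    fix x assume "x \<in> nprod ?S (Suc (Suc n))"
    then obtain y z where x: "x = y * z" and y: "y \<in> nprod ?S (Suc n)" and z: "z \<in> ?S"
      unfolding nprod.simps(2)[of ?S "Suc n"] by (rule set_times_elim)
    obtain r w u where y: "y = r * (w * u)" "w \<in> nprod ?P n" "u \<in> U"
      using Suc y by (auto elim!: set_times_elim dest!: subsetD)
    obtain s v where z: "z = s * (e * v)" "v \<in> U"
      using z by (auto elim!: set_times_elim)
    \<comment> \<open>The \<open>e\<close> inserted after \<open>w\<close> becomes the left end of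
      the new corner element \<open>e * (u * s) * e\<close>; its right end comes from
      \<open>z\<close>.\<close>
    have "x = r * ((w * e) * u) * (s * (e * v))"
      using nprod_corner_right_unit[OF e y(2)] by (simp add: x y z)
    then have "x = r * ((w * (e * (u * s) * e)) * v)"
      by (simp add: mult.assoc)
    moreover have "u * s \<in> U"
      using U y by (auto simp: two_sided_ideal_def)
    ultimately show "x \<in> UNIV * (nprod ?P (Suc n) * U)"
      using y(2) z(2) by (auto intro!: set_times_intro)
  qed
qed

lemma nilpotent_corner_ideal:
  assumes U: "two_sided_ideal U" and e: "e * e = e"
    and "nilpotent ((\<lambda>u. e * u * e) ` U)"
  shows "nilpotent (group_closure (UNIV * ({e} * U)))"
proof -
  obtain n where "nprod ((\<lambda>u. e * u * e) ` U) n \<subseteq> {0}"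
    using assms(3) by (auto simp: nilpotent_iff)
  then have "UNIV * (nprod ((\<lambda>u. e * u * e) ` U) n * U) \<subseteq> {0}"
    by (auto elim!: set_times_elim)
  then have "nprod (UNIV * ({e} * U)) (Suc n) \<subseteq> {0}"
    using nprod_corner_ideal[OF U e, of n] by (rule order_trans[rotated])
  then show ?thesis
    by (intro nilpotent_group_closure) (auto simp only: nilpotent_iff)
qed

text \<open>On generators, \<open>(r * one e * s) * u = r * (one e * (s * u))\<close> with
  \<open>s * u\<close> in \<open>U\<close>; additivity does the rest.\<close>

lemma ideal_at_mult_mem:
  assumes U: "two_sided_ideal U" and x: "x \<in> ideal_at one e" and u: "u \<in> U"
  shows "x * u \<in> group_closure (UNIV * ({one e} * U))"
    (is "_ \<in> group_closure ?S")
proof -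
  have S: "(r * one e * s) * u \<in> group_closure ?S" for r s
  proof -
    have "s * u \<in> U"
      using U u by (auto simp: two_sided_ideal_def)
    then have "r * (one e * (s * u)) \<in> ?S"
      by auto
    then show ?thesis
      by (auto simp: mult.assoc intro: group_closure.base)
  qed
  have C: "add_subgroup {y. y * u \<in> group_closure ?S}"
    by (auto simp: add_subgroup_def left_diff_distrib intro: group_closure.diff)
  have "group_closure (UNIV * {one e}) * group_closure UNIV \<subseteq> {y. y * u \<in> group_closure ?S}"
    using S by (intro group_closure_mult_mem[OF C]) (auto elim!: set_times_elim)
  \<comment> \<open>The definition of \<open>ideal_at\<close> has a bare \<open>UNIV\<close> on the
    right; enlarging it to its closure gives the form bounded above.\<close>
  moreover have "group_closure (UNIV * {one e}) * UNIV
      \<subseteq> group_closure (UNIV * {one e}) * group_closure UNIV"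
    by (intro set_times_mono2 order_refl group_closure_increasing)
  ultimately have "ideal_at one e \<subseteq> {y. y * u \<in> group_closure ?S}"
    unfolding ideal_at_def sg_prod_def by (intro group_closure_least[OF C]) blast
  then show ?thesis
    using x by blast
qed

section \<open>From nilpotent corners to nilpotent \<open>U\<close>\<close>

lemma nilpotent_if_corners_nilpotent:
  assumes U: "two_sided_ideal U" and \<Delta>: "d_generating \<Gamma> one \<Delta>"
    and idem: "\<And>e. e \<in> \<Delta> \<Longrightarrow> one e * one e = one e"
    and nil: "\<And>e. e \<in> \<Delta> \<Longrightarrow> nilpotent ((\<lambda>u. one e * u * one e) ` U)"
  shows "nilpotent U"
proof -
  let ?I = "\<lambda>e. group_closure (UNIV * ({one e} * U))"
  have fin: "finite \<Delta>" and gen: "x \<in> (\<Sum>e\<in>\<Delta>. ideal_at one e)" for x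
    using \<Delta> UNIV_I[of x] unfolding d_generating_def by (metis, metis)
  have "nilpotent (\<Sum>e\<in>\<Delta>. ?I e)"
    using nilpotent_ideal_sum[OF fin, of ?I] two_sided_ideal_corner_ideal[OF U]
      nilpotent_corner_ideal[OF U idem nil] by blast
  \<comment> \<open>Index \<open>Suc 0\<close> means two factors: the left one is decomposed along
    the ideals \<open>ideal_at one e\<close>, the right one supplies the element of
    \<open>U\<close>.\<close>
  moreover have "nprod U (Suc 0) \<subseteq> (\<Sum>e\<in>\<Delta>. ?I e)"
  proof
    fix x assume "x \<in> nprod U (Suc 0)"
    then obtain u v where "x = u * v" "v \<in> U"
      by (auto elim!: set_times_elim)
    then show "x \<in> (\<Sum>e\<in>\<Delta>. ?I e)"
      using sum_set_mult_right[OF fin gen, where B = ?I] ideal_at_mult_mem[OF U, of _ one] by simp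
  qed
  ultimately show ?thesis
    by (rule nilpotent_nprod_subset)
qed

section \<open>Corners and the objectwise conditions\<close>

lemma nprod_corner_left:
  assumes U: "two_sided_ideal U"
  shows "nprod ((\<lambda>u. e * u * e) ` U) n \<subseteq> (\<lambda>x. e * x) ` nprod U n"
proof (induction n)
  case 0
  show ?case
    using U by (auto simp: two_sided_ideal_def mult.assoc)
next
  case (Suc n)
  show ?case
  proof
    fix x assume "x \<in> nprod ((\<lambda>u. e * u * e) ` U) (Suc n)"
    then obtain p u where x: "x = (e * p) * (e * u * e)" "p \<in> nprod U n" "u \<in> U"
      using Suc by (auto elim!: set_times_elim)
    have "x = e * (p * (e * u * e))"
      by (simp add: x mult.assoc)
    moreover have "e * u * e \<in> U"
      using U x by (auto simp: two_sided_ideal_def)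
    ultimately show "x \<in> (\<lambda>x. e * x) ` nprod U (Suc n)"
      using x(2) by auto
  qed
qed

text \<open>Mirror image of \<open>nprod_corner_left\<close>: only the last \<open>e\<close> stays
  outside, and the ideal \<open>U\<close> absorbs all the others.\<close>

lemma nprod_corner_right:
  assumes U: "two_sided_ideal U"
  shows "nprod ((\<lambda>u. e * u * e) ` U) n \<subseteq> (\<lambda>x. x * e) ` nprod U n"
proof (induction n)
  case 0
  show ?case
    using U by (auto simp: two_sided_ideal_def)
next
  case (Suc n)
  show ?case
  proof
    fix x assume "x \<in> nprod ((\<lambda>u. e * u * e) ` U) (Suc n)"
    then obtain p u where x: "x = (p * e) * (e * u * e)" "p \<in> nprod U n" "u \<in> U"
      using Suc by (auto elim!: set_times_elim)
    have "x = (p * (e * (e * u))) * e"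
      by (simp add: x mult.assoc)
    moreover have "e * (e * u) \<in> U"
      using U x by (auto simp: two_sided_ideal_def)
    ultimately show "x \<in> (\<lambda>x. x * e) ` nprod U (Suc n)"
      using x(2) by auto
  qed
qed

text \<open>Here \<open>h\<close> stands for left or right multiplication by \<open>one e\<close>,
  and \<open>P\<close> for the corner at \<open>e\<close>.\<close>

lemma nilpotent_if_nprod_subset_image:
  assumes "n > 0" "h ` sg_power U n = {0}" "\<And>m. nprod P m \<subseteq> h ` nprod U m"
  shows "nilpotent P"
proof -
  have "nprod P (n - 1) \<subseteq> h ` sg_power U n"
    using assms(1,3) nprod_subset_sg_power[of U "n - 1"] by fastforce
  then show ?thesis
    using assms(2) by (auto simp: nilpotent_iff)
qed

text \<open>Since \<open>rg \<Gamma> e = e\<close>, the axiom \<open>one_left\<close> applies to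
  \<open>one e\<close> itself.\<close>

lemma (in graded_ring) one_idempotent:
  assumes "e \<in> idents \<Gamma>"
  shows "one e * one e = one e"
proof -
  obtain x where x: "x \<in> Obj \<Gamma>" "e = Idt \<Gamma> x"
    using assms by (auto simp: idents_def)
  then have "e \<in> Mor \<Gamma>" "rg \<Gamma> e = e"
    by (simp_all add: Idt_Mor rg_eq Tgt_Idt)
  then show ?thesis
    using one_left[of e "one e"] one_mem[OF assms] by simp
qed

theorem lemma8p6:
  fixes \<Gamma> :: "('o, 'g) cat"
    and R :: "'g \<Rightarrow> 'a::ring set"
    and one :: "'g \<Rightarrow> 'a"
    and \<Delta> :: "'g set"
    and U :: "'a set"
  assumes "graded_ring \<Gamma> R one"
    and "d_finitely_generated \<Gamma> one"
    and "d_generating \<Gamma> one \<Delta>"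
    and "graded_ideal \<Gamma> R U"
  shows "(nilpotent U \<longleftrightarrow> right_objectwise_nilpotent \<Gamma> one U)
    \<and> (nilpotent U \<longleftrightarrow> left_objectwise_nilpotent \<Gamma> one U)
    \<and> (nilpotent U \<longleftrightarrow> object_nilpotent \<Gamma> one U)
    \<and> (nilpotent U \<longleftrightarrow> (\<forall>e\<in>\<Delta>. nilpotent ((\<lambda>u. one e * u * one e) ` U)))"
proof -
  interpret graded_ring \<Gamma> R one
    by fact
  let ?P = "\<lambda>e. (\<lambda>u. one e * u * one e) ` U"
  have U: "two_sided_ideal U"
    using assms(4) by (simp add: graded_ideal_def)
  have \<Delta>: "\<Delta> \<subseteq> idents \<Gamma>"
    using assms(3) by (simp add: d_generating_def)
  \<comment> \<open>This closes every cycle: each condition follows from nilpotency of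
    \<open>U\<close> and yields nilpotent corners over \<open>\<Delta>\<close>.\<close>
  have corners: "nilpotent U" if "\<And>e. e \<in> \<Delta> \<Longrightarrow> nilpotent (?P e)"
    using nilpotent_if_corners_nilpotent[OF U assms(3)] one_idempotent that \<Delta> by blast
  have corner: "nilpotent (?P e)" if "nilpotent U" for e
    using U by (intro nilpotent_subset[OF that]) (auto simp: two_sided_ideal_def)
  have objectwise: "right_objectwise_nilpotent \<Gamma> one U" "left_objectwise_nilpotent \<Gamma> one U"
    if "nilpotent U"
    using that unfolding nilpotent_def right_objectwise_nilpotent_def left_objectwise_nilpotent_def
    by fastforce+
  have object: "object_nilpotent \<Gamma> one U" if "nilpotent U"
  proof -
    have "nilpotent ((\<lambda>u. one e * u) ` U)" for e
      using U by (intro nilpotent_subset[OF that]) (auto simp: two_sided_ideal_def)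
    then show ?thesis
      by (simp add: object_nilpotent_def nilpotent_def)
  qed
  have "nilpotent U" if "right_objectwise_nilpotent \<Gamma> one U"
    using that \<Delta> nilpotent_if_nprod_subset_image[OF _ _ nprod_corner_left[OF U]]
    unfolding right_objectwise_nilpotent_def by (intro corners) (meson subsetD)
  moreover have "nilpotent U" if "left_objectwise_nilpotent \<Gamma> one U"
    using that \<Delta> nilpotent_if_nprod_subset_image[OF _ _ nprod_corner_right[OF U]]
    unfolding left_objectwise_nilpotent_def by (intro corners) (meson subsetD)
  moreover have "nilpotent U" if "object_nilpotent \<Gamma> one U"
  proof (rule corners)
    fix e assume "e \<in> \<Delta>"
    then have "nilpotent ((\<lambda>u. one e * u) ` U)"
      using that \<Delta> by (auto simp: object_nilpotent_def nilpotent_def)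
    \<comment> \<open>The corner lies in \<open>one e * U\<close>, because \<open>u * one e\<close>
      is again in \<open>U\<close>.\<close>
    then show "nilpotent (?P e)"
      using U by (elim nilpotent_subset) (auto simp: two_sided_ideal_def mult.assoc)
  qed
  ultimately show ?thesis
    using corners corner objectwise object by blast
qed

end
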